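(* Let $n\ge1$, $B=(b_{ij})_{1\le i,j\le n}\in\mathcal{M}_{n\times n}(\mathbb{R})$, let $(X,d)$ be a complete vector $B$-metric space with $X$ nonempty, and let $N\colon X\to X$ be an operator such that $$d(N(x),N(y))\le A\,d(x,y)\quad\text{for all }x,y\in X$$ with a matrix $A\in\mathcal{M}_{n\times n}(\mathbb{R}_+)$ convergent to zero. In addition assume that either (a) $B$ and $I-\tilde bA$ are inverse-positive, where $\tilde b=\max\{b_{ii}: i=1,2,\ldots,n\}$; or (b) $B$ is positive and $I-BA$ is inverse-positive. Then $N$ has the Ostrowski property, i.e., $N$ has a unique fixed point $x^\ast$, and for every sequence $(x_k)\subset X$ satisfying $d(x_{k+1},N(x_k))\to0$ as $k\to\infty$, one has $x_k\to x^\ast$ as $k\to\infty$.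
   Context: Vectors in $\mathbb{R}^n$ are columns; inequalities between vectors (and between matrices of the same size) and convergence of sequences of vectors or matrices are understood componentwise; $\mathbb{R}_+=[0,\infty)$; $I$ is the $n\times n$ identity matrix. For a set $X$ and an arbitrary matrix $B\in\mathcal{M}_{n\times n}(\mathbb{R})$, a vector $B$-metric on $X$ is a mapping $d\colon X\times X\to\mathbb{R}^n_+$ such that for all $u,v,w\in X$: $d(u,v)=0$ if and only if $u=v$; $d(u,v)=d(v,u)$; and $d(u,w)\le B\,(d(u,v)+d(v,w))$. Then $(X,d)$ is called a vector $B$-metric space. A sequence $(x_k)$ converges to $x$ (written $x_k\to x$) if $d(x_k,x)\to 0$; it is Cauchy if $d(x_k,x_p)\to0$ as $k,p\to\infty$; $(X,d)$ is complete if every Cauchy sequence converges to a point of $X$. A matrix is positive if all its entries are nonnegative; a square real matrix is inverse-positive if it is invertible and its inverse is positive; a positive matrix $M$ is convergent to zero if $M^k\to 0$ as $k\to\infty$. *)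

theory Defs
  imports "HOL-Analysis.Analysis"
begin

text \<open>
  Vectors are of type \<open>real ^ 'n\<close> and square matrices of type \<open>real ^ 'n ^ 'n\<close>. The library order
  and topology on these types are the componentwise ones. Since every type is nonempty, the
  dimension \<open>CARD('n)\<close> is an arbitrary positive number.
\<close>

definition positive_matrix :: "real ^ 'n ^ 'm \<Rightarrow> bool" where
  "positive_matrix M \<longleftrightarrow> 0 \<le> M"

definition inverse_positive :: "real ^ 'n ^ 'n \<Rightarrow> bool" where
  "inverse_positive M \<longleftrightarrow> invertible M \<and> positive_matrix (matrix_inv M)"

text \<open>
  The overloaded operation \<open>M ^ k\<close> on \<open>real ^ 'n ^ 'n\<close> is the entrywise power, hence this separate
  power with respect to the matrix product.
\<close>

primrec matrix_power :: "real ^ 'n ^ 'n \<Rightarrow> nat \<Rightarrow> real ^ 'n ^ 'n" where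
  "matrix_power M 0 = mat 1"
| "matrix_power M (Suc k) = M ** matrix_power M k"

definition convergent_to_zero :: "real ^ 'n ^ 'n \<Rightarrow> bool" where
  "convergent_to_zero M \<longleftrightarrow> positive_matrix M \<and> matrix_power M \<longlonglongrightarrow> 0"

text \<open>
  The underlying set \<open>X\<close> is an explicit carrier; values of \<open>d\<close> outside \<open>X\<close> are irrelevant.
\<close>

definition vector_B_metric ::
    "real ^ 'n ^ 'n \<Rightarrow> 'a set \<Rightarrow> ('a \<Rightarrow> 'a \<Rightarrow> real ^ 'n) \<Rightarrow> bool" where
  "vector_B_metric B X d \<longleftrightarrow>
     (\<forall>u\<in>X. \<forall>v\<in>X. 0 \<le> d u v) \<and>
     (\<forall>u\<in>X. \<forall>v\<in>X. d u v = 0 \<longleftrightarrow> u = v) \<and>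
     (\<forall>u\<in>X. \<forall>v\<in>X. d u v = d v u) \<and>
     (\<forall>u\<in>X. \<forall>v\<in>X. \<forall>w\<in>X. d u w \<le> B *v (d u v + d v w))"

definition vconverges :: "('a \<Rightarrow> 'a \<Rightarrow> real ^ 'n) \<Rightarrow> (nat \<Rightarrow> 'a) \<Rightarrow> 'a \<Rightarrow> bool" where
  "vconverges d x l \<longleftrightarrow> (\<lambda>k. d (x k) l) \<longlonglongrightarrow> 0"

definition vCauchy :: "('a \<Rightarrow> 'a \<Rightarrow> real ^ 'n) \<Rightarrow> (nat \<Rightarrow> 'a) \<Rightarrow> bool" where
  "vCauchy d x \<longleftrightarrow> ((\<lambda>(k, p). d (x k) (x p)) \<longlongrightarrow> 0) (sequentially \<times>\<^sub>F sequentially)"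

definition vcomplete :: "'a set \<Rightarrow> ('a \<Rightarrow> 'a \<Rightarrow> real ^ 'n) \<Rightarrow> bool" where
  "vcomplete X d \<longleftrightarrow>
     (\<forall>x. (\<forall>k. x k \<in> X) \<and> vCauchy d x \<longrightarrow> (\<exists>l\<in>X. vconverges d x l))"

definition Ostrowski_property ::
    "'a set \<Rightarrow> ('a \<Rightarrow> 'a \<Rightarrow> real ^ 'n) \<Rightarrow> ('a \<Rightarrow> 'a) \<Rightarrow> bool" where
  "Ostrowski_property X d N \<longleftrightarrow>
     (\<exists>z\<in>X. N z = z \<and> (\<forall>y\<in>X. N y = y \<longrightarrow> y = z) \<and>
        (\<forall>x. (\<forall>k. x k \<in> X) \<and> (\<lambda>k. d (x (Suc k)) (N (x k))) \<longlonglongrightarrow> 0 \<longrightarrow> vconverges d x z))"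

end

theory Submission
  imports Defs
begin

text \<open>
  Passing from the vector distance \<open>d\<close> to the number \<open>r u v = norm (d u v)\<close> loses nothing here. The
  Euclidean norm is monotone on nonnegative vectors, and \<open>0 \<le> d u w \<le> B *v (d u v + d v w)\<close>, so
  \<open>r u w \<le> K * (r u v + r v w)\<close> with \<open>K = 1 + norm B\<close>, where \<open>norm B\<close> is the Frobenius norm
  and the summand \<open>1\<close> only serves to have \<open>K \<ge> 1\<close>;
  convergence, Cauchy sequences and completeness mean the same for \<open>r\<close> as for \<open>d\<close>.

  The map \<open>N\<close> need not contract \<open>r\<close>, but its iterates do: since \<open>A\<close> is positive, \<open>N\<^sup>m\<close> satisfies the
  vector contraction inequality with \<open>A\<^sup>m\<close>, and \<open>A\<^sup>m \<rightarrow> 0\<close>. Hence some \<open>T = N\<^sup>m\<close> with \<open>m > 0\<close> is a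
  contraction for \<open>r\<close> whose factor \<open>q\<close> is so small that \<open>K * q \<le> 1/2\<close>. This beats the constant of
  the triangle inequality, and the argument of Banach goes through for \<open>T\<close>
  (\<open>contraction_fixed_point\<close>). The unique fixed point of \<open>T\<close> is also that of \<open>N\<close>, because \<open>N\<close>
  commutes with \<open>T\<close>.

  An approximate orbit of \<open>N\<close> shadows the true one over a fixed number of steps: if
  \<open>r (x (k + 1)) (N (x k)) \<rightarrow> 0\<close>, then \<open>r (x (k + m)) (T (x k)) \<rightarrow> 0\<close>
  (\<open>approximate_orbit_funpow\<close>). For the errors \<open>e k = r (x k) z\<close> at the fixed point \<open>z\<close> this yields
  \<open>e (k + m) \<le> s k + e k / 2\<close> with \<open>s k \<rightarrow> 0\<close>, which forces \<open>e k \<rightarrow> 0\<close>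
  (\<open>tendsto_zero_if_halving\<close>).
\<close>

section \<open>Null sequences from a delayed recursive inequality\<close>

text \<open>
  Once \<open>s\<close> stays below \<open>\<epsilon>\<close>, every block of \<open>m\<close> steps at least halves an excess of \<open>e\<close> over \<open>2 * \<epsilon>\<close>. The
  starting values of the \<open>m\<close> residue classes are finitely many, hence have a common bound.
\<close>
lemma tendsto_zero_if_halving:
  fixes e s :: "nat \<Rightarrow> real"
  assumes nonneg: "\<And>k. 0 \<le> e k"
    and rec: "\<And>k. e (k + m) \<le> s k + e k / 2"
    and s: "s \<longlonglongrightarrow> 0"
    and m: "0 < m"
  shows "e \<longlonglongrightarrow> 0"
proof (rule LIMSEQ_I)
  fix \<epsilon>' :: real
  assume "0 < \<epsilon>'"
  define \<epsilon> where "\<epsilon> = \<epsilon>' / 3"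
  have "0 < \<epsilon>" using \<open>0 < \<epsilon>'\<close> by (simp add: \<epsilon>_def)
  obtain n where n: "\<And>k. n \<le> k \<Longrightarrow> s k < \<epsilon>"
    using order_tendstoD(2)[OF s \<open>0 < \<epsilon>\<close>] by (auto simp: eventually_sequentially)
  define M where "M = (\<Sum>i<m. e (n + i))"
  have M0: "0 \<le> M" by (simp add: M_def sum_nonneg nonneg)
  have start: "e (n + i) \<le> M" if "i < m" for i
    unfolding M_def using that
    by (intro member_le_sum[of i "{..<m}" "\<lambda>i. e (n + i)"]) (auto simp: nonneg)
  have decay: "e (n + i + j * m) \<le> 2 * \<epsilon> + M / 2 ^ j" if "i < m" for i j
  proof (induction j)
    case 0
    show ?case using start[OF that] \<open>0 < \<epsilon>\<close> by simp
  next
    case (Suc j)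
    have "e (n + i + j * m + m) \<le> s (n + i + j * m) + e (n + i + j * m) / 2" by (rule rec)
    also have "\<dots> \<le> \<epsilon> + (2 * \<epsilon> + M / 2 ^ j) / 2"
      using Suc n[of "n + i + j * m"] by (intro add_mono divide_right_mono) auto
    also have "\<dots> = 2 * \<epsilon> + M / 2 ^ Suc j" by simp
    finally show ?case by (simp add: add_ac)
  qed
  have "(\<lambda>j. M * (1 / 2) ^ j) \<longlonglongrightarrow> 0"
    by (intro tendsto_mult_right_zero LIMSEQ_power_zero) auto
  then have "(\<lambda>j. M / 2 ^ j) \<longlonglongrightarrow> 0" by (simp add: power_one_over)
  from order_tendstoD(2)[OF this \<open>0 < \<epsilon>\<close>]
  obtain J where J: "\<And>j. J \<le> j \<Longrightarrow> M / 2 ^ j < \<epsilon>" by (auto simp: eventually_sequentially)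
  show "\<exists>no. \<forall>k\<ge>no. norm (e k - 0) < \<epsilon>'"
  proof (intro exI allI impI)
    fix k
    assume k: "n + J * m \<le> k"
    define i j where "i = (k - n) mod m" and "j = (k - n) div m"
    have "J \<le> j" unfolding j_def using k m by (simp add: less_eq_div_iff_mult_less_eq)
    moreover have "k = n + i + j * m" using k by (simp add: i_def j_def)
    moreover have "i < m" using m by (simp add: i_def)
    ultimately have "e k < 3 * \<epsilon>" using decay[of i j] J[of j] by simp
    then show "norm (e k - 0) < \<epsilon>'" using nonneg[of k] by (simp add: \<epsilon>_def)
  qed
qed


section \<open>Scalar distances with a relaxed triangle inequality\<close>

locale b_metric =
  fixes X :: "'a set" and r :: "'a \<Rightarrow> 'a \<Rightarrow> real" and K :: real
  assumes nonneg: "0 \<le> r u v"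
    and zero_iff: "\<lbrakk>u \<in> X; v \<in> X\<rbrakk> \<Longrightarrow> r u v = 0 \<longleftrightarrow> u = v"
    and sym: "\<lbrakk>u \<in> X; v \<in> X\<rbrakk> \<Longrightarrow> r u v = r v u"
    and triangle: "\<lbrakk>u \<in> X; v \<in> X; w \<in> X\<rbrakk> \<Longrightarrow> r u w \<le> K * (r u v + r v w)"
    and K_ge_1: "1 \<le> K"
begin

text \<open>
  The usual estimate of \<open>r x (T\<^sup>p x)\<close> by a telescoping sum would pick up a power of \<open>K\<close> per step.
  Splitting off only the first step instead and using that \<open>T\<close> contracts the rest, one gets
  \<open>r x (T\<^sup>p\<^sup>+\<^sup>1 x) \<le> K * r x (T x) + K * q * r x (T\<^sup>p x)\<close>, and \<open>K * q \<le> 1/2\<close> keeps this bounded.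
\<close>
lemma contraction_orbit_bounded:
  assumes T: "T \<in> X \<rightarrow> X"
    and contr: "\<And>x y. \<lbrakk>x \<in> X; y \<in> X\<rbrakk> \<Longrightarrow> r (T x) (T y) \<le> q * r x y"
    and Kq: "K * q \<le> 1 / 2"
    and x: "x \<in> X"
  shows "r x ((T ^^ p) x) \<le> 2 * K * r x (T x)"
proof (induction p)
  case 0
  show ?case using zero_iff[OF x x] nonneg[of x "T x"] K_ge_1 by simp
next
  case (Suc p)
  have orbit: "(T ^^ k) x \<in> X" for k by (induction k) (use T x in auto)
  have "r x ((T ^^ Suc p) x) \<le> K * (r x (T x) + r (T x) ((T ^^ Suc p) x))"
    using x T orbit[of "Suc p"] by (intro triangle) auto
  also have "\<dots> \<le> K * (r x (T x) + q * r x ((T ^^ p) x))"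
    using contr[OF x orbit[of p]] K_ge_1 by (intro mult_left_mono) auto
  also have "\<dots> = K * r x (T x) + (K * q) * r x ((T ^^ p) x)" by (simp add: algebra_simps)
  also have "\<dots> \<le> K * r x (T x) + 1 / 2 * (2 * K * r x (T x))"
    using Suc Kq nonneg[of x "(T ^^ p) x"] nonneg[of x "T x"] K_ge_1
    by (intro add_left_mono mult_mono) auto
  finally show ?case by simp
qed

lemma contraction_funpow:
  assumes T: "T \<in> X \<rightarrow> X"
    and contr: "\<And>x y. \<lbrakk>x \<in> X; y \<in> X\<rbrakk> \<Longrightarrow> r (T x) (T y) \<le> q * r x y"
    and q: "0 \<le> q"
    and xy: "x \<in> X" "y \<in> X"
  shows "r ((T ^^ k) x) ((T ^^ k) y) \<le> q ^ k * r x y"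
proof (induction k)
  case (Suc k)
  have orbit: "(T ^^ k) u \<in> X" if "u \<in> X" for u by (induction k) (use T that in auto)
  have "r ((T ^^ Suc k) x) ((T ^^ Suc k) y) \<le> q * r ((T ^^ k) x) ((T ^^ k) y)"
    using contr[OF orbit orbit, OF xy] by simp
  also have "\<dots> \<le> q * (q ^ k * r x y)" using Suc q by (intro mult_left_mono)
  finally show ?case by (simp add: mult.assoc)
qed simp

text \<open>
  The distance \<open>r\<close> need not be continuous for its own convergence, so one cannot pass to the limit
  in \<open>r (y k) (y (k + 1))\<close>. Instead the limit \<open>z\<close> of the orbit is compared with \<open>T z\<close> through one
  relaxed triangle inequality whose right-hand side tends to \<open>0\<close>.
\<close>
lemma contraction_fixed_point:
  assumes complete: "\<And>x. \<lbrakk>\<And>k. x k \<in> X; \<And>\<epsilon>. 0 < \<epsilon> \<Longrightarrow> \<exists>n. \<forall>k\<ge>n. \<forall>p\<ge>n. r (x k) (x p) < \<epsilon>\<rbrakk>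
        \<Longrightarrow> \<exists>l\<in>X. (\<lambda>k. r (x k) l) \<longlonglongrightarrow> 0"
    and "X \<noteq> {}"
    and T: "T \<in> X \<rightarrow> X"
    and contr: "\<And>x y. \<lbrakk>x \<in> X; y \<in> X\<rbrakk> \<Longrightarrow> r (T x) (T y) \<le> q * r x y"
    and q: "0 \<le> q" and Kq: "K * q \<le> 1 / 2"
  obtains z where "z \<in> X" "T z = z" "\<And>y. \<lbrakk>y \<in> X; T y = y\<rbrakk> \<Longrightarrow> y = z"
proof -
  \<comment> \<open>As \<open>K \<ge> 1\<close>, the map \<open>T\<close> is in particular an ordinary contraction, with factor at most \<open>1/2\<close>.\<close>
  have q_half: "q \<le> 1 / 2" using mult_right_mono[OF K_ge_1 q] Kq by simp
  obtain x where x: "x \<in> X" using \<open>X \<noteq> {}\<close> by blast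
  define y where "y k = (T ^^ k) x" for k
  have y: "y k \<in> X" for k unfolding y_def by (induction k) (use T x in auto)
  define C where "C = 2 * K * r x (T x)"
  have close: "r (y k) (y p) \<le> q ^ k * C" if "k \<le> p" for k p
  proof -
    have "y p = (T ^^ k) (y (p - k))"
      using that by (simp add: y_def flip: funpow_add comp_apply[of "T ^^ k"])
    then have "r (y k) (y p) \<le> q ^ k * r x (y (p - k))"
      using contraction_funpow[OF T contr q x y] by (simp add: y_def[of k])
    also have "\<dots> \<le> q ^ k * C"
      using contraction_orbit_bounded[OF T contr Kq x] q
      by (intro mult_left_mono) (auto simp: C_def y_def)
    finally show ?thesis .
  qed
  have "(\<lambda>k. q ^ k * C) \<longlonglongrightarrow> 0"
    using q q_half by (intro tendsto_mult_left_zero LIMSEQ_power_zero) auto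
  note small = order_tendstoD(2)[OF this]
  have "\<exists>n. \<forall>k\<ge>n. \<forall>p\<ge>n. r (y k) (y p) < \<epsilon>" if eps: "0 < \<epsilon>" for \<epsilon>
  proof -
    obtain n where n: "\<And>k. n \<le> k \<Longrightarrow> q ^ k * C < \<epsilon>"
      using small[OF eps] by (auto simp: eventually_sequentially)
    have *: "r (y k) (y p) < \<epsilon>" if "n \<le> k" "k \<le> p" for k p
      using close[of k p] n[of k] that by simp
    have "r (y k) (y p) < \<epsilon>" if "n \<le> k" "n \<le> p" for k p
      using *[of k p] *[of p k] sym[OF y y, of k p] that by (cases "k \<le> p") auto
    then show ?thesis by blast
  qed
  then obtain z where z: "z \<in> X" and lim: "(\<lambda>k. r (y k) z) \<longlonglongrightarrow> 0" using complete[of y] y by blast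
  have Tz: "T z \<in> X" using T z by auto
  have "r (T z) z \<le> K * (q * r (y k) z + r (y (Suc k)) z)" for k
  proof -
    have "r (T z) z \<le> K * (r (T z) (y (Suc k)) + r (y (Suc k)) z)"
      using Tz y z by (intro triangle)
    also have "r (T z) (y (Suc k)) \<le> q * r (y k) z"
      using contr[OF z y[of k]] sym[OF z y[of k]] by (simp add: y_def)
    finally show ?thesis using K_ge_1 by (simp add: mult_left_mono)
  qed
  moreover have "(\<lambda>k. K * (q * r (y k) z + r (y (Suc k)) z)) \<longlonglongrightarrow> K * (q * 0 + 0)"
    by (intro tendsto_intros lim LIMSEQ_Suc[OF lim])
  ultimately have "r (T z) z \<le> 0" by (intro LIMSEQ_le_const) auto
  then have fix_z: "T z = z" using nonneg[of "T z" z] zero_iff[OF Tz z] by simp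
  have "u = z" if u: "u \<in> X" "T u = u" for u
  proof -
    have "r u z \<le> q * r u z" using contr[OF u(1) z] u(2) fix_z by simp
    also have "\<dots> \<le> 1 / 2 * r u z" using q_half nonneg by (intro mult_right_mono)
    finally have "r u z = 0" using nonneg[of u z] by simp
    then show ?thesis using zero_iff[OF u(1) z] by simp
  qed
  then show ?thesis using that z fix_z by blast
qed

text \<open>
  In the passage from \<open>j\<close> to \<open>j + 1\<close> steps the old error is transported by \<open>N\<close>, which multiplies it
  by at most \<open>L\<close>, and one new one-step error is added; the triangle inequality costs a factor \<open>K\<close>.
  The resulting constants grow with \<open>j\<close>, which is harmless because \<open>j\<close> is fixed while \<open>k\<close> grows.
\<close>
lemma approximate_orbit_funpow:
  assumes N: "N \<in> X \<rightarrow> X"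
    and lipschitz: "\<And>x y. \<lbrakk>x \<in> X; y \<in> X\<rbrakk> \<Longrightarrow> r (N x) (N y) \<le> L * r x y"
    and x: "\<And>k. x k \<in> X"
    and step: "(\<lambda>k. r (x (Suc k)) (N (x k))) \<longlonglongrightarrow> 0"
  shows "(\<lambda>k. r (x (k + j)) ((N ^^ j) (x k))) \<longlonglongrightarrow> 0"
proof (induction j)
  case 0
  show ?case using zero_iff[OF x x, THEN iffD2, OF refl] by simp
next
  case (Suc j)
  have orbit: "(N ^^ j) (x k) \<in> X" for j k by (induction j) (use N x in auto)
  have bound: "r (x (k + Suc j)) ((N ^^ Suc j) (x k))
      \<le> K * (r (x (Suc (k + j))) (N (x (k + j))) + L * r (x (k + j)) ((N ^^ j) (x k)))" for k
  proof -
    have "r (x (k + Suc j)) ((N ^^ Suc j) (x k))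
        \<le> K * (r (x (k + Suc j)) (N (x (k + j))) + r (N (x (k + j))) ((N ^^ Suc j) (x k)))"
      using x orbit[of "Suc j" k] N by (intro triangle) auto
    also have "\<dots> \<le> K * (r (x (k + Suc j)) (N (x (k + j))) + L * r (x (k + j)) ((N ^^ j) (x k)))"
      using lipschitz[OF x[of "k + j"] orbit[of j k]] K_ge_1 by (intro mult_left_mono) auto
    finally show ?thesis by simp
  qed
  have "(\<lambda>k. K * (r (x (Suc (k + j))) (N (x (k + j))) + L * r (x (k + j)) ((N ^^ j) (x k))))
      \<longlonglongrightarrow> K * (0 + L * 0)"
    by (intro tendsto_intros Suc LIMSEQ_ignore_initial_segment[OF step])
  then have lim: "(\<lambda>k. K * (r (x (Suc (k + j))) (N (x (k + j)))
      + L * r (x (k + j)) ((N ^^ j) (x k)))) \<longlonglongrightarrow> 0" by simp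
  show ?case
    by (rule tendsto_sandwich[OF _ _ tendsto_const lim]) (use nonneg bound in auto)
qed

lemma approximate_orbit_tendsto:
  assumes N: "N \<in> X \<rightarrow> X"
    and lipschitz: "\<And>x y. \<lbrakk>x \<in> X; y \<in> X\<rbrakk> \<Longrightarrow> r (N x) (N y) \<le> L * r x y"
    and contr: "\<And>x y. \<lbrakk>x \<in> X; y \<in> X\<rbrakk> \<Longrightarrow> r ((N ^^ m) x) ((N ^^ m) y) \<le> q * r x y"
    and m: "0 < m" and Kq: "K * q \<le> 1 / 2"
    and z: "z \<in> X" "(N ^^ m) z = z"
    and x: "\<And>k. x k \<in> X"
    and step: "(\<lambda>k. r (x (Suc k)) (N (x k))) \<longlonglongrightarrow> 0"
  shows "(\<lambda>k. r (x k) z) \<longlonglongrightarrow> 0"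
proof (rule tendsto_zero_if_halving[OF nonneg _ _ m])
  define s where "s k = K * r (x (k + m)) ((N ^^ m) (x k))" for k
  show "s \<longlonglongrightarrow> 0"
    unfolding s_def
    using tendsto_mult_right_zero[OF approximate_orbit_funpow[OF N lipschitz x step]] .
  fix k
  have "(N ^^ m) (x k) \<in> X" by (induction m) (use N x in auto)
  then have "r (x (k + m)) z \<le> K * (r (x (k + m)) ((N ^^ m) (x k)) + r ((N ^^ m) (x k)) z)"
    using x z by (intro triangle)
  also have "\<dots> \<le> K * (r (x (k + m)) ((N ^^ m) (x k)) + q * r (x k) z)"
    using contr[OF x[of k] z(1)] z(2) K_ge_1 by (intro mult_left_mono) auto
  also have "\<dots> = s k + (K * q) * r (x k) z" by (simp add: s_def algebra_simps)
  also have "\<dots> \<le> s k + 1 / 2 * r (x k) z"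
    using Kq nonneg by (intro add_left_mono mult_right_mono)
  finally show "r (x (k + m)) z \<le> s k + r (x k) z / 2" by simp
qed

end


section \<open>Norms of nonnegative vectors and matrices\<close>

text \<open>The Frobenius norm dominates the operator norm, by Cauchy-Schwarz in each row.\<close>
lemma norm_matrix_vector_mult_le:
  fixes M :: "real ^ 'n ^ 'm"
  shows "norm (M *v x) \<le> norm M * norm x"
proof -
  have "norm (M *v x) \<le> L2_set (\<lambda>i. norm (M $ i) * norm x) UNIV"
    unfolding norm_vec_def[of "M *v x"]
    by (rule L2_set_mono) (auto simp: matrix_vector_mul_component Cauchy_Schwarz_ineq2)
  also have "\<dots> = norm M * norm x"
    by (simp add: norm_vec_def[of M] L2_set_left_distrib)
  finally show ?thesis .
qed

lemma norm_mono_nonneg_vec: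
  fixes x y :: "real ^ 'n"
  assumes "0 \<le> x" "x \<le> y"
  shows "norm x \<le> norm y"
proof (rule norm_le_componentwise_cart)
  show "norm (x $ i) \<le> norm (y $ i)" for i
    using assms[unfolded less_eq_vec_def, rule_format, of i] by simp
qed

lemma matrix_vector_mult_mono:
  fixes M :: "real ^ 'n ^ 'm"
  assumes "positive_matrix M" "x \<le> y"
  shows "M *v x \<le> M *v y"
  using assms
  by (auto simp: positive_matrix_def less_eq_vec_def matrix_vector_mult_def
      intro!: sum_mono mult_left_mono)

text \<open>
  Here the positivity of \<open>A\<close> enters: only a positive matrix may be applied to both sides of the
  inequality for the previous iterate.
\<close>
lemma vector_contraction_funpow:
  assumes N: "N \<in> X \<rightarrow> X"
    and contr: "\<forall>x\<in>X. \<forall>y\<in>X. d (N x) (N y) \<le> A *v d x y"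
    and A: "positive_matrix A"
    and xy: "x \<in> X" "y \<in> X"
  shows "d ((N ^^ k) x) ((N ^^ k) y) \<le> matrix_power A k *v d x y"
proof (induction k)
  case (Suc k)
  have orbit: "(N ^^ k) u \<in> X" if "u \<in> X" for u by (induction k) (use N that in auto)
  have "d ((N ^^ Suc k) x) ((N ^^ Suc k) y) \<le> A *v d ((N ^^ k) x) ((N ^^ k) y)"
    using contr orbit[OF xy(1)] orbit[OF xy(2)] by simp
  also have "\<dots> \<le> A *v (matrix_power A k *v d x y)"
    using Suc A by (rule matrix_vector_mult_mono[rotated])
  finally show ?case by (simp add: matrix_vector_mul_assoc)
qed simp

lemma vector_B_metric_norm:
  assumes "vector_B_metric B X d"
  shows "b_metric X (\<lambda>u v. norm (d u v)) (1 + norm B)"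
proof
  fix u v w
  assume X: "u \<in> X" "v \<in> X" "w \<in> X"
  have "0 \<le> d u w" "d u w \<le> B *v (d u v + d v w)"
    using assms X by (auto simp: vector_B_metric_def)
  then have "norm (d u w) \<le> norm (B *v (d u v + d v w))" by (rule norm_mono_nonneg_vec)
  also have "\<dots> \<le> norm B * norm (d u v + d v w)" by (rule norm_matrix_vector_mult_le)
  also have "\<dots> \<le> (1 + norm B) * (norm (d u v) + norm (d v w))"
    by (intro mult_mono norm_triangle_ineq) auto
  finally show "norm (d u w) \<le> (1 + norm B) * (norm (d u v) + norm (d v w))" .
qed (use assms in \<open>auto simp: vector_B_metric_def\<close>)

lemma vcomplete_norm:
  assumes "vcomplete X d"
    and x: "\<And>k. x k \<in> X"
    and Cauchy: "\<And>\<epsilon>. 0 < \<epsilon> \<Longrightarrow> \<exists>n. \<forall>k\<ge>n. \<forall>p\<ge>n. norm (d (x k) (x p)) < \<epsilon>"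
  shows "\<exists>l\<in>X. (\<lambda>k. norm (d (x k) l)) \<longlonglongrightarrow> 0"
proof -
  have "vCauchy d x"
    unfolding vCauchy_def
  proof (rule tendstoI)
    fix \<epsilon> :: real
    assume "0 < \<epsilon>"
    from Cauchy[OF this]
    show "\<forall>\<^sub>F kp in sequentially \<times>\<^sub>F sequentially. dist (case kp of (k, p) \<Rightarrow> d (x k) (x p)) 0 < \<epsilon>"
      by (auto simp: eventually_prod_sequentially)
  qed
  then show ?thesis
    using assms(1) x by (auto simp: vcomplete_def vconverges_def tendsto_norm_zero_iff)
qed


section \<open>The Ostrowski property\<close>

theorem theorem3p7:
  fixes A B :: "real ^ 'n ^ 'n"
    and X :: "'a set"
    and d :: "'a \<Rightarrow> 'a \<Rightarrow> real ^ 'n"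
    and N :: "'a \<Rightarrow> 'a"
  assumes "vector_B_metric B X d"
    and "vcomplete X d"
    and "X \<noteq> {}"
    and "N \<in> X \<rightarrow> X"
    and "\<forall>x\<in>X. \<forall>y\<in>X. d (N x) (N y) \<le> A *v d x y"
    and "positive_matrix A"
    and "convergent_to_zero A"
    and "(inverse_positive B \<and>
            inverse_positive (mat 1 - Max (range (\<lambda>i. B $ i $ i)) *\<^sub>R A)) \<or>
         (positive_matrix B \<and> inverse_positive (mat 1 - B ** A))"
  shows "Ostrowski_property X d N"
proof -
  define r where "r u v = norm (d u v)" for u v
  define K where "K = 1 + norm B"
  define q where "q = 1 / (2 * K)"
  have K: "0 < K" by (simp add: K_def add_pos_nonneg)
  have q: "0 < q" "K * q \<le> 1 / 2" using K by (auto simp: q_def)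
  interpret b_metric X r K
    unfolding r_def K_def by (rule vector_B_metric_norm) fact
  note N = \<open>N \<in> X \<rightarrow> X\<close>
  have scalar: "r u v \<le> norm M * r x y"
    if "u \<in> X" "v \<in> X" "d u v \<le> M *v d x y" for u v x y M
  proof -
    have "0 \<le> d u v" using assms(1) that by (auto simp: vector_B_metric_def)
    then have "r u v \<le> norm (M *v d x y)" unfolding r_def using that(3) by (rule norm_mono_nonneg_vec)
    also have "\<dots> \<le> norm M * r x y" unfolding r_def by (rule norm_matrix_vector_mult_le)
    finally show ?thesis .
  qed
  have orbit: "(N ^^ k) x \<in> X" if "x \<in> X" for k x by (induction k) (use N that in auto)
  have lipschitz: "r (N x) (N y) \<le> norm A * r x y" if "x \<in> X" "y \<in> X" for x y
    using assms(5) N that by (intro scalar) auto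

  have "(\<lambda>k. norm (matrix_power A k)) \<longlonglongrightarrow> 0"
    using assms(7) by (simp add: convergent_to_zero_def tendsto_norm_zero)
  from eventually_conj[OF order_tendstoD(2)[OF this q(1)] eventually_gt_at_top[of 0]]
  obtain m where m: "norm (matrix_power A m) < q" "0 < m"
    by (auto simp: eventually_sequentially)
  have contr: "r ((N ^^ m) x) ((N ^^ m) y) \<le> q * r x y" if "x \<in> X" "y \<in> X" for x y
  proof -
    have "r ((N ^^ m) x) ((N ^^ m) y) \<le> norm (matrix_power A m) * r x y"
      using orbit that vector_contraction_funpow[OF N assms(5,6)] by (intro scalar) auto
    also have "\<dots> \<le> q * r x y" using m(1) nonneg by (intro mult_right_mono) auto
    finally show ?thesis .
  qed

  have T: "N ^^ m \<in> X \<rightarrow> X" using orbit by auto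
  have complete: "\<exists>l\<in>X. (\<lambda>k. r (x k) l) \<longlonglongrightarrow> 0"
    if "\<And>k. x k \<in> X" "\<And>\<epsilon>. 0 < \<epsilon> \<Longrightarrow> \<exists>n. \<forall>k\<ge>n. \<forall>p\<ge>n. r (x k) (x p) < \<epsilon>" for x
    using that unfolding r_def by (rule vcomplete_norm[OF \<open>vcomplete X d\<close>])
  obtain z where z: "z \<in> X" "(N ^^ m) z = z"
    and unique: "\<And>y. \<lbrakk>y \<in> X; (N ^^ m) y = y\<rbrakk> \<Longrightarrow> y = z"
    using contraction_fixed_point[OF complete \<open>X \<noteq> {}\<close> T contr less_imp_le[OF q(1)] q(2)] by metis
  show ?thesis
    unfolding Ostrowski_property_def
  proof (intro bexI[of _ z] conjI ballI allI impI)
    \<comment> \<open>Since \<open>N\<close> commutes with \<open>N\<^sup>m\<close>, the point \<open>N z\<close> is a fixed point of \<open>N\<^sup>m\<close> as well.\<close>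
    show "N z = z"
      using unique[of "N z"] N z by (simp add: funpow_swap1[symmetric] Pi_iff)
    show "y = z" if "y \<in> X" "N y = y" for y
    proof -
      have "(N ^^ m) y = y" by (induction m) (use that in auto)
      then show ?thesis using unique that by blast
    qed
    fix x
    assume x: "(\<forall>k. x k \<in> X) \<and> (\<lambda>k. d (x (Suc k)) (N (x k))) \<longlonglongrightarrow> 0"
    then have "(\<lambda>k. r (x (Suc k)) (N (x k))) \<longlonglongrightarrow> 0" by (simp add: r_def tendsto_norm_zero)
    with x have "(\<lambda>k. r (x k) z) \<longlonglongrightarrow> 0"
      by (intro approximate_orbit_tendsto[OF N lipschitz contr m(2) q(2) z]) auto
    then show "vconverges d x z" by (simp add: vconverges_def r_def tendsto_norm_zero_iff)
  qed (fact z(1))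
qed

end
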